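(* Assume that $\Phi(u)=0$ for $\mu$-a.e. $u$ in some interval $(0,\delta)$, $\delta>0$. 1) The Hausdorff operator $\mathbb{H}_{\Phi,\mu}$ is bounded on the Paley–Wiener space $PW$ if $\Phi(u)\sqrt u$ is $\mu$-integrable on $[\delta,\infty)$, and in this case $$\|\mathbb{H}_{\Phi,\mu}\|\le\int_\delta^\infty|\Phi(u)|\sqrt u\,d\mu(u).$$ 2) If the operator $\mathbb{H}_{\Phi,\mu}$ is defined on the Paley–Wiener space $PW$, then $\Phi$ is $\mu$-integrable on $[\delta,\infty)$.
   Context: $\mu$ is a regular positive Borel measure on $(0,\infty)$ and $\Phi:(0,\infty)\to\mathbb{C}$ is $\mu$-measurable. The Hausdorff operator is $$(\mathbb{H}_{\Phi,\mu}F)(z)=\int_0^\infty \Phi(u)\,F\left(\tfrac{z}{u}\right)d\mu(u),\quad z\in\mathbb{C}.$$ $PW=PW_\pi$ is the space of entire functions of exponential type (at most) $\pi$ whose restrictions to $\mathbb{R}$ belong to $L^2(\mathbb{R})$, with the $L^2(\mathbb{R})$ norm. (Equivalently, $PW$ is the de Branges space $\mathcal{H}(e^{-i\pi z})$.)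
   Formalization: In part 1, for δ<1 boundedness is into PW_{π/δ} with the L² norm, not into PW_π; for δ≥1 it is on PW_π as stated. The literal claim fails for δ<1: with μ the unit mass at 1/2 and Φ=1, HF(z)=F(2z) doubles the exponential type. *)

theory Defs
  imports "HOL-Analysis.Analysis"
begin

definition regular_borel_measure :: "real measure \<Rightarrow> bool" where
  "regular_borel_measure \<mu> \<longleftrightarrow>
     sets \<mu> = sets (restrict_space borel {0<..}) \<and>
     (\<forall>K. compact K \<and> K \<subseteq> {0<..} \<longrightarrow> emeasure \<mu> K < \<infinity>) \<and>
     (\<forall>B\<in>sets \<mu>.
        emeasure \<mu> B = (INF U\<in>{U. open U \<and> B \<subseteq> U \<and> U \<subseteq> {0<..}}. emeasure \<mu> U) \<and>
        emeasure \<mu> B = (SUP K\<in>{K. compact K \<and> K \<subseteq> B}. emeasure \<mu> K))"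

definition exp_type_at_most :: "real \<Rightarrow> (complex \<Rightarrow> complex) \<Rightarrow> bool" where
  "exp_type_at_most \<sigma> F \<longleftrightarrow>
     (\<forall>\<epsilon>>0. \<exists>C. \<forall>z. norm (F z) \<le> C * exp ((\<sigma> + \<epsilon>) * norm z))"

definition PW :: "real \<Rightarrow> (complex \<Rightarrow> complex) set" where
  "PW \<sigma> = {F. F holomorphic_on UNIV \<and> exp_type_at_most \<sigma> F \<and>
               integrable lborel (\<lambda>x::real. (norm (F (of_real x)))\<^sup>2)}"

definition PW_norm :: "(complex \<Rightarrow> complex) \<Rightarrow> real" where
  "PW_norm F = sqrt (LINT x|lborel. (norm (F (of_real x)))\<^sup>2)"

(* Integrals are taken with respect to the completion of the measure, since the symbol is only
   assumed measurable with respect to the completed sigma-algebra. The domain of integration is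
   (0,\<infinity>), the underlying space of a measure satisfying regular_borel_measure. *)
definition hausdorff_op ::
    "(real \<Rightarrow> complex) \<Rightarrow> real measure \<Rightarrow> (complex \<Rightarrow> complex) \<Rightarrow> complex \<Rightarrow> complex" where
  "hausdorff_op \<Phi> \<mu> F z = (LINT u|completion \<mu>. \<Phi> u * F (z / of_real u))"

(* A non-integrable function has Bochner integral 0, so well-definedness of the operator on a
   class of functions has to be expressed separately. *)
definition hausdorff_defined_on ::
    "(real \<Rightarrow> complex) \<Rightarrow> real measure \<Rightarrow> (complex \<Rightarrow> complex) set \<Rightarrow> bool" where
  "hausdorff_defined_on \<Phi> \<mu> A \<longleftrightarrow>
     (\<forall>F\<in>A. \<forall>z. integrable (completion \<mu>) (\<lambda>u. \<Phi> u * F (z / of_real u)))"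

definition bounded_operator ::
    "(complex \<Rightarrow> complex) set \<Rightarrow> (complex \<Rightarrow> complex) set \<Rightarrow>
     ((complex \<Rightarrow> complex) \<Rightarrow> complex \<Rightarrow> complex) \<Rightarrow> bool" where
  "bounded_operator A B T \<longleftrightarrow>
     T ` A \<subseteq> B \<and>
     (\<forall>F\<in>A. \<forall>G\<in>A. \<forall>a b. T (\<lambda>z. a * F z + b * G z) = (\<lambda>z. a * T F z + b * T G z)) \<and>
     (\<exists>C. \<forall>F\<in>A. PW_norm (T F) \<le> C * PW_norm F)"

definition operator_norm ::
    "(complex \<Rightarrow> complex) set \<Rightarrow> ((complex \<Rightarrow> complex) \<Rightarrow> complex \<Rightarrow> complex) \<Rightarrow> real" where
  "operator_norm A T = (SUP F\<in>{F\<in>A. PW_norm F \<le> 1}. PW_norm (T F))"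

(* If the symbol vanishes only on (0,\<delta>) with \<delta> < 1, the operator need not map PW pi into itself:
   for the unit mass at 1/2 and symbol 1 it is F \<mapsto> F(2z), which doubles the exponential type.
   The dilations z \<mapsto> z/u with u \<ge> \<delta> yield type at most pi/\<delta>, so boundedness is meant from
   PW pi into PW (max pi (pi/\<delta>)), with the same L2 norm; for \<delta> \<ge> 1 this target is PW pi. *)

end

theory Submission
  imports Defs "HOL-Complex_Analysis.Cauchy_Integral_Formula" "HOL-Probability.Sinc_Integral"
begin

text \<open>
  Once the symbol is cut off to \<open>{\<delta>..}\<close>, the operator is an average of the dilations
  \<open>F \<mapsto> F(\<cdot>/u)\<close> with \<open>u \<ge> \<delta>\<close>. Such a dilation preserves entire functions, multiplies the
  exponential type by \<open>1/u \<le> 1/\<delta>\<close> and the \<open>L\<^sup>2\<close> norm by \<open>sqrt u\<close>; all three facts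
  survive averaging.

  For a fixed \<open>z\<close> the arguments \<open>z/u\<close> stay in the disc of radius \<open>|z|/\<delta>\<close>. Hence the
  integral converges as soon as the symbol is integrable, which the weighted integrability implies
  because \<open>sqrt u \<ge> sqrt \<delta>\<close> on the support; and the Taylor series of \<open>F\<close> at \<open>0\<close>
  can be integrated term by term, so the image is entire (\<open>dilation_average_holomorphic\<close>).
  The norm bound is Minkowski's integral inequality for the dilations. It is obtained here from
  the Cauchy-Schwarz inequality and Tonelli's theorem for the finite measure with density
  \<open>|\<Phi>(u)| sqrt u\<close> (\<open>dilation_average_L2_bound\<close>); passing to this
  finite measure is what makes Tonelli's theorem applicable.

  Conversely, at \<open>z = 0\<close> the integrand is \<open>\<Phi>(u) F(0)\<close>, so one function in the
  Paley-Wiener space with \<open>F(0) \<noteq> 0\<close> forces \<open>\<Phi>\<close> to be integrable. The function \<open>sin (\<pi> z) / z\<close>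
  is such a function (\<open>sinc_pi_in_PW\<close>).
\<close>

section \<open>Averages of dilations\<close>

lemma continuous_bounded_on_disc:
  fixes F :: "complex \<Rightarrow> complex"
  assumes "continuous_on UNIV F"
  obtains B where "B \<ge> 1" "\<And>w. norm w \<le> r \<Longrightarrow> norm (F w) \<le> B"
proof -
  have "compact (F ` cball 0 r)"
    using assms by (intro compact_continuous_image) (auto intro: continuous_on_subset)
  then have "bounded (F ` cball 0 r)" by (rule compact_imp_bounded)
  then obtain B where "\<forall>y\<in>F ` cball 0 r. norm y \<le> B"
    unfolding bounded_iff by blast
  then show ?thesis using that[of "max 1 B"] by (force simp: le_max_iff_disj)
qed

text \<open>
  In the application \<open>M\<close> is the completed measure and \<open>\<Psi>\<close> the symbol cut off to \<open>{\<delta>..}\<close>. The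
  vanishing below \<open>\<delta>\<close> is required everywhere, so that bounds on the integrand hold pointwise and
  the points \<open>u \<le> 0\<close> are harmless.
\<close>

locale dilation_average =
  fixes M :: "real measure" and \<Psi> :: "real \<Rightarrow> complex" and \<delta> :: real
  assumes pos: "\<delta> > 0"
    and meas_id [measurable]: "(\<lambda>u. u) \<in> borel_measurable M"
    and integrable_symbol: "integrable M \<Psi>"
    and symbol_eq_0: "\<And>u. u < \<delta> \<Longrightarrow> \<Psi> u = 0"
begin

definition average :: "(complex \<Rightarrow> complex) \<Rightarrow> complex \<Rightarrow> complex" where
  "average F z = (LINT u|M. \<Psi> u * F (z / of_real u))"

lemma symbol_measurable [measurable]: "\<Psi> \<in> borel_measurable M"
  using integrable_symbol by (rule borel_measurable_integrable)

lemma integrand_measurable: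
  fixes F :: "complex \<Rightarrow> complex"
  assumes "continuous_on UNIV F"
  shows "(\<lambda>u. \<Psi> u * F (z / of_real u)) \<in> borel_measurable M"
proof -
  have [measurable]: "F \<in> borel_measurable borel"
    using assms by (rule borel_measurable_continuous_onI)
  show ?thesis by measurable
qed

lemma integrand_bound:
  fixes F :: "complex \<Rightarrow> complex"
  assumes "\<And>w. norm w \<le> norm z / \<delta> \<Longrightarrow> norm (F w) \<le> B"
  shows "norm (\<Psi> u * F (z / of_real u)) \<le> norm (\<Psi> u) * B"
proof (cases "u < \<delta>")
  case False
  then have "norm (z / of_real u) \<le> norm z / \<delta>"
    using pos by (auto simp: norm_divide intro!: divide_left_mono)
  then show ?thesis
    using assms by (auto simp: norm_mult intro!: mult_left_mono)
qed (simp add: symbol_eq_0)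

lemma integrand_integrable:
  fixes F :: "complex \<Rightarrow> complex"
  assumes "continuous_on UNIV F"
  shows "integrable M (\<lambda>u. \<Psi> u * F (z / of_real u))"
proof -
  obtain B where B: "\<And>w. norm w \<le> norm z / \<delta> \<Longrightarrow> norm (F w) \<le> B"
    using continuous_bounded_on_disc[OF assms] by blast
  have "integrable M (\<lambda>u. norm (\<Psi> u) * B)"
    using integrable_symbol by simp
  then show ?thesis
    by (rule Bochner_Integration.integrable_bound)
       (use integrand_measurable[OF assms] integrand_bound[of z F, OF B] in
        \<open>auto intro: order_trans[OF _ abs_ge_self]\<close>)
qed

lemma average_norm_le:
  assumes "continuous_on UNIV F" "\<And>w. norm w \<le> norm z / \<delta> \<Longrightarrow> norm (F w) \<le> B"
  shows "norm (average F z) \<le> (LINT u|M. norm (\<Psi> u)) * B"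
proof -
  have "norm (average F z) \<le> (LINT u|M. norm (\<Psi> u) * B)"
    unfolding average_def
    using integrand_integrable[OF assms(1)] integrable_symbol integrand_bound[OF assms(2)]
    by (intro Bochner_Integration.integral_norm_bound_integral) auto
  then show ?thesis using integrable_symbol by simp
qed

text \<open>
  Integrating \<open>F(z/u) = \<Sum> a\<^sub>n z\<^sup>n/u\<^sup>n\<close> term by term gives an everywhere convergent power series in
  \<open>z\<close>. The interchange is justified because on the support of the symbol the \<open>n\<close>-th term is at
  most \<open>|\<Psi>(u)| |a\<^sub>n| (|z|/\<delta>)\<^sup>n\<close>, and the Taylor series of an entire function converges absolutely.
\<close>

lemma dilation_average_holomorphic:
  assumes hol: "F holomorphic_on UNIV"
  shows "average F holomorphic_on UNIV"
proof -
  define a where "a n = (deriv ^^ n) F 0 / fact n" for n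
  have Fsums: "(\<lambda>n. a n * w ^ n) sums F w" for w
    using holomorphic_power_series[of F 0 "norm w + 1" w] hol
    unfolding a_def by (auto intro: holomorphic_on_subset)
  have abs_summable: "summable (\<lambda>n. norm (a n * w ^ n))" for w :: complex
    using powser_insidea[of a "of_real (norm w + 1)" w] Fsums sums_summable by fastforce
  define c where "c n = (LINT u|M. \<Psi> u * (1 / of_real u) ^ n) * a n" for n
  have "(\<lambda>n. c n * z ^ n) sums average F z" for z
  proof -
    define f where "f n u = \<Psi> u * (a n * (z / of_real u) ^ n)" for n u
    have f_int: "integrable M (f n)" for n
      unfolding f_def by (rule integrand_integrable) (intro continuous_intros)
    have f_le: "norm (f n u) \<le> norm (\<Psi> u) * norm (a n * of_real (norm z / \<delta>) ^ n)" for n u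
      unfolding f_def
      by (rule integrand_bound[of z "\<lambda>w. a n * w ^ n"])
         (use pos in \<open>auto simp: norm_mult norm_power norm_divide intro!: mult_left_mono power_mono\<close>)
    have f_eq: "f n u = (\<Psi> u * (1 / of_real u) ^ n) * (a n * z ^ n)" for n u
      by (simp add: f_def power_divide)
    have integral_f: "integral\<^sup>L M (f n) = c n * z ^ n" for n
      unfolding f_eq c_def by simp
    have "(\<lambda>n. integral\<^sup>L M (f n)) sums (LINT u|M. (\<Sum>n. f n u))"
    proof (rule sums_integral[OF f_int])
      show "AE u in M. summable (\<lambda>n. norm (f n u))"
        using abs_summable by (auto simp: f_def norm_mult)
      show "summable (\<lambda>n. LINT u|M. norm (f n u))"
      proof (rule summable_comparison_test')
        show "summable (\<lambda>n. (LINT u|M. norm (\<Psi> u)) * norm (a n * of_real (norm z / \<delta>) ^ n))"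
          by (intro summable_mult abs_summable)
        have "(LINT u|M. norm (f n u)) \<le> (LINT u|M. norm (\<Psi> u) * norm (a n * of_real (norm z / \<delta>) ^ n))" for n
          by (intro integral_mono f_le integrable_norm f_int integrable_mult_left integrable_symbol)
        then show "norm (LINT u|M. norm (f n u))
            \<le> (LINT u|M. norm (\<Psi> u)) * norm (a n * of_real (norm z / \<delta>) ^ n)" for n
          by simp
      qed
    qed
    moreover have "(\<Sum>n. f n u) = \<Psi> u * F (z / of_real u)" for u
      unfolding f_def using sums_mult[OF Fsums] sums_unique by metis
    ultimately show ?thesis
      by (simp add: integral_f average_def)
  qed
  then have "average F holomorphic_on ball 0 r" for r
    using power_series_holomorphic[of 0 r c "average F"] by simp
  then have "average F field_differentiable (at z)" for z
    using holomorphic_on_imp_differentiable_at[of "average F" "ball 0 (norm z + 1)" z] by simp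
  then show ?thesis by (simp add: holomorphic_on_def)
qed

text \<open>
  The slack \<open>\<epsilon>\<close> in the type of the average comes from slack \<open>\<epsilon> \<delta>\<close> in the type of \<open>F\<close>, because the
  arguments \<open>z/u\<close> are at most \<open>|z|/\<delta>\<close> in modulus.
\<close>

lemma dilation_average_exp_type:
  assumes "continuous_on UNIV F" "exp_type_at_most \<sigma> F" "\<sigma> \<ge> 0"
  shows "exp_type_at_most (\<sigma> / \<delta>) (average F)"
  unfolding exp_type_at_most_def
proof (intro allI impI)
  fix \<epsilon> :: real assume "\<epsilon> > 0"
  then have "\<epsilon> * \<delta> > 0" using pos by simp
  then obtain C where C: "\<And>z. norm (F z) \<le> C * exp ((\<sigma> + \<epsilon> * \<delta>) * norm z)"
    using assms(2) unfolding exp_type_at_most_def by blast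
  have "C \<ge> 0" using order_trans[OF norm_ge_zero C[of 0]] by simp
  have "norm (average F z) \<le> (LINT u|M. norm (\<Psi> u)) * (C * exp ((\<sigma> / \<delta> + \<epsilon>) * norm z))" for z
  proof (rule average_norm_le[OF assms(1)])
    fix w :: complex assume "norm w \<le> norm z / \<delta>"
    then have "(\<sigma> + \<epsilon> * \<delta>) * norm w \<le> (\<sigma> + \<epsilon> * \<delta>) * (norm z / \<delta>)"
      using \<open>\<epsilon> * \<delta> > 0\<close> assms(3) by (intro mult_left_mono) auto
    also have "\<dots> = (\<sigma> / \<delta> + \<epsilon>) * norm z"
      using pos by (simp add: field_simps)
    finally show "norm (F w) \<le> C * exp ((\<sigma> / \<delta> + \<epsilon>) * norm z)"
      using C[of w] \<open>C \<ge> 0\<close> by (meson exp_le_cancel_iff mult_left_mono order_trans)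
  qed
  then show "\<exists>C. \<forall>z. norm (average F z) \<le> C * exp ((\<sigma> / \<delta> + \<epsilon>) * norm z)"
    by (auto simp flip: mult.assoc)
qed

text \<open>
  The factor \<open>1/u\<close> that the Cauchy-Schwarz inequality leaves behind cancels the Jacobian \<open>u\<close> of the
  dilation, so after exchanging the integrals each dilation contributes the same amount.
\<close>

lemma dilation_average_L2_bound:
  assumes cont: "continuous_on UNIV F"
    and W: "integrable M (\<lambda>u. norm (\<Psi> u) * sqrt u)"
  shows "(\<integral>\<^sup>+x. ennreal ((norm (average F (of_real x)))\<^sup>2) \<partial>lborel)
    \<le> ennreal ((LINT u|M. norm (\<Psi> u) * sqrt u)\<^sup>2)
        * (\<integral>\<^sup>+x. ennreal ((norm (F (of_real x)))\<^sup>2) \<partial>lborel)"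
proof -
  define w where "w u = norm (\<Psi> u) * sqrt u" for u
  define \<nu> where "\<nu> = density M (\<lambda>u. ennreal (w u))"
  define N where "N = (\<integral>\<^sup>+x. ennreal ((norm (F (of_real x)))\<^sup>2) \<partial>lborel)"
  have w_nonneg: "w u \<ge> 0" for u
    using pos symbol_eq_0[of u] by (cases "u < \<delta>") (auto simp: w_def)
  have [measurable]: "w \<in> borel_measurable M" unfolding w_def by measurable
  have [measurable]: "F \<in> borel_measurable borel"
    using cont by (rule borel_measurable_continuous_onI)
  have sets_\<nu> [measurable_cong, simp]: "sets \<nu> = sets M" by (simp add: \<nu>_def)
  have total: "emeasure \<nu> (space \<nu>) = ennreal (LINT u|M. w u)"
    using W w_nonneg unfolding \<nu>_def w_def[symmetric]
    by (simp add: emeasure_density nn_integral_eq_integral cong: nn_integral_cong)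
  interpret fin: finite_measure \<nu>
    by (rule finite_measureI) (simp add: total)
  interpret pair_sigma_finite lborel \<nu> ..
  have AE_\<nu>: "AE u in \<nu>. u > 0"
    unfolding \<nu>_def using pos symbol_eq_0
    by (subst AE_density) (auto simp: w_def not_less intro!: AE_I2 less_le_trans[of 0 \<delta>], 
        metis less_irrefl mult_zero_left norm_zero not_le)
  have pointwise: "ennreal ((norm (average F (of_real x)))\<^sup>2)
      \<le> ennreal (LINT u|M. w u) * (\<integral>\<^sup>+u. ennreal ((norm (F (of_real x / of_real u)))\<^sup>2 / u) \<partial>\<nu>)" for x
  proof -
    have "ennreal (norm (average F (of_real x))) \<le> (\<integral>\<^sup>+u. ennreal (norm (\<Psi> u * F (of_real x / of_real u))) \<partial>M)"
      unfolding average_def by (rule integral_norm_bound_ennreal[OF integrand_integrable[OF cont]])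
    also have "\<dots> = (\<integral>\<^sup>+u. ennreal (w u) * ennreal (norm (F (of_real x / of_real u)) / sqrt u) \<partial>M)"
    proof (rule nn_integral_cong)
      fix u
      have "norm (\<Psi> u * F (of_real x / of_real u)) = w u * (norm (F (of_real x / of_real u)) / sqrt u)"
        using pos symbol_eq_0[of u] by (cases "u < \<delta>") (auto simp: w_def norm_mult)
      then show "ennreal (norm (\<Psi> u * F (of_real x / of_real u)))
          = ennreal (w u) * ennreal (norm (F (of_real x / of_real u)) / sqrt u)"
        using w_nonneg[of u] by (simp only: ennreal_mult')
    qed
    also have "\<dots> = (\<integral>\<^sup>+u. ennreal (norm (F (of_real x / of_real u)) / sqrt u) * 1 \<partial>\<nu>)"
      unfolding \<nu>_def by (subst nn_integral_density) auto
    finally have "(ennreal (norm (average F (of_real x))))\<^sup>2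
        \<le> (\<integral>\<^sup>+u. ennreal (norm (F (of_real x / of_real u)) / sqrt u) * 1 \<partial>\<nu>)\<^sup>2"
      by (rule power_mono) simp
    also have "\<dots> \<le> (\<integral>\<^sup>+u. (ennreal (norm (F (of_real x / of_real u)) / sqrt u))\<^sup>2 \<partial>\<nu>) * (\<integral>\<^sup>+u. 1\<^sup>2 \<partial>\<nu>)"
      by (rule Cauchy_Schwarz_nn_integral) measurable
    also have "(\<integral>\<^sup>+u. (ennreal (norm (F (of_real x / of_real u)) / sqrt u))\<^sup>2 \<partial>\<nu>)
        = (\<integral>\<^sup>+u. ennreal ((norm (F (of_real x / of_real u)))\<^sup>2 / u) \<partial>\<nu>)"
      using AE_\<nu>
      by (intro nn_integral_cong_AE, eventually_elim) (simp add: ennreal_power power_divide)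
    finally show ?thesis
      by (simp add: ennreal_power total mult.commute)
  qed
  have dilated: "(\<integral>\<^sup>+x. ennreal ((norm (F (of_real x / of_real u)))\<^sup>2 / u) \<partial>lborel) = N" if "u > 0" for u :: real
  proof -
    have "(\<integral>\<^sup>+x. ennreal ((norm (F (of_real x / of_real u)))\<^sup>2 / u) \<partial>lborel)
        = ennreal \<bar>u\<bar> * (\<integral>\<^sup>+x. ennreal ((norm (F (of_real (0 + u * x) / of_real u)))\<^sup>2 / u) \<partial>lborel)"
      using that by (intro nn_integral_real_affine) auto
    also have "\<dots> = (\<integral>\<^sup>+x. ennreal u * ennreal ((norm (F (of_real x)))\<^sup>2 / u) \<partial>lborel)"
      using that by (subst nn_integral_cmult) auto
    also have "\<dots> = N"
      unfolding N_def using that by (intro nn_integral_cong) (simp flip: ennreal_mult)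
    finally show ?thesis .
  qed
  have "(\<integral>\<^sup>+x. ennreal ((norm (average F (of_real x)))\<^sup>2) \<partial>lborel)
      \<le> (\<integral>\<^sup>+x. ennreal (LINT u|M. w u) * (\<integral>\<^sup>+u. ennreal ((norm (F (of_real x / of_real u)))\<^sup>2 / u) \<partial>\<nu>) \<partial>lborel)"
    by (intro nn_integral_mono pointwise)
  also have "\<dots> = ennreal (LINT u|M. w u) * (\<integral>\<^sup>+x. (\<integral>\<^sup>+u. ennreal ((norm (F (of_real x / of_real u)))\<^sup>2 / u) \<partial>\<nu>) \<partial>lborel)"
    by (rule nn_integral_cmult) measurable
  also have "(\<integral>\<^sup>+x. (\<integral>\<^sup>+u. ennreal ((norm (F (of_real x / of_real u)))\<^sup>2 / u) \<partial>\<nu>) \<partial>lborel)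
      = (\<integral>\<^sup>+u. (\<integral>\<^sup>+x. ennreal ((norm (F (of_real x / of_real u)))\<^sup>2 / u) \<partial>lborel) \<partial>\<nu>)"
    by (rule Fubini'[symmetric]) measurable
  also have "\<dots> = (\<integral>\<^sup>+u. N \<partial>\<nu>)"
    using AE_\<nu> by (intro nn_integral_cong_AE, eventually_elim) (rule dilated)
  also have "ennreal (LINT u|M. w u) * \<dots> = ennreal ((LINT u|M. w u)\<^sup>2) * N"
    using w_nonneg
    by (simp add: total power2_eq_square ennreal_mult integral_nonneg_AE mult_ac)
  finally show ?thesis unfolding N_def w_def .
qed

text \<open>
  The average lands in the Paley-Wiener space of type \<open>\<sigma>/\<delta>\<close>, which is larger than the original
  one when \<open>\<delta> < 1\<close>, since a dilation \<open>F(\<cdot>/u)\<close> with \<open>u < 1\<close> raises the type.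
\<close>

lemma dilation_average_PW:
  assumes F: "F \<in> PW \<sigma>" and "\<sigma> \<ge> 0"
    and W: "integrable M (\<lambda>u. norm (\<Psi> u) * sqrt u)"
  shows "average F \<in> PW (\<sigma> / \<delta>)"
    and "PW_norm (average F) \<le> (LINT u|M. norm (\<Psi> u) * sqrt u) * PW_norm F"
proof -
  let ?W = "LINT u|M. norm (\<Psi> u) * sqrt u"
  let ?n = "\<lambda>F x. (norm (F (complex_of_real x)))\<^sup>2"
  have hol: "F holomorphic_on UNIV" and L2: "integrable lborel (?n F)"
    and type: "exp_type_at_most \<sigma> F"
    using F by (auto simp: PW_def)
  have cont: "continuous_on UNIV F"
    using hol by (rule holomorphic_on_imp_continuous_on)
  have hol': "average F holomorphic_on UNIV"
    using hol by (rule dilation_average_holomorphic)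
  have [measurable]: "average F \<in> borel_measurable borel"
    using hol' by (intro borel_measurable_continuous_onI holomorphic_on_imp_continuous_on)
  have W_nonneg: "?W \<ge> 0"
  proof (rule integral_nonneg_AE, rule AE_I2)
    show "0 \<le> norm (\<Psi> u) * sqrt u" for u
      using pos symbol_eq_0[of u] by (cases "u < \<delta>") auto
  qed
  have bound: "(\<integral>\<^sup>+x. ennreal (?n (average F) x) \<partial>lborel) \<le> ennreal (?W\<^sup>2 * (LINT x|lborel. ?n F x))"
    using dilation_average_L2_bound[OF cont W]
    by (simp add: nn_integral_eq_integral[OF L2] ennreal_mult)
  have L2': "integrable lborel (?n (average F))"
    using bound by (intro integrableI_bounded) (auto simp: le_less_trans)
  then show "average F \<in> PW (\<sigma> / \<delta>)"
    using hol' dilation_average_exp_type[OF cont type \<open>\<sigma> \<ge> 0\<close>] by (simp add: PW_def)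
  have "(LINT x|lborel. ?n (average F) x) \<le> ?W\<^sup>2 * (LINT x|lborel. ?n F x)"
    using bound by (simp add: nn_integral_eq_integral[OF L2'] zero_le_mult_iff)
  then have "PW_norm (average F) \<le> sqrt (?W\<^sup>2 * (LINT x|lborel. ?n F x))"
    unfolding PW_norm_def by (rule real_sqrt_le_mono)
  then show "PW_norm (average F) \<le> ?W * PW_norm F"
    using W_nonneg by (simp add: PW_norm_def real_sqrt_mult)
qed

end

lemma PW_mono:
  assumes "\<sigma> \<le> \<tau>" shows "PW \<sigma> \<subseteq> PW \<tau>"
proof -
  have "exp_type_at_most \<tau> F" if F: "exp_type_at_most \<sigma> F" for F
    unfolding exp_type_at_most_def
  proof (intro allI impI)
    fix \<epsilon> :: real assume "\<epsilon> > 0"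
    then have "\<tau> - \<sigma> + \<epsilon> > 0" using assms by simp
    then show "\<exists>C. \<forall>z. norm (F z) \<le> C * exp ((\<tau> + \<epsilon>) * norm z)"
      using F[unfolded exp_type_at_most_def, rule_format, of "\<tau> - \<sigma> + \<epsilon>"] by simp
  qed
  then show ?thesis by (auto simp: PW_def)
qed

section \<open>The cardinal sine\<close>

text \<open>
  This is \<open>\<pi>\<close> times the normalised cardinal sine; in this scaling it is the difference quotient
  of \<open>sin (\<pi> z)\<close> at \<open>0\<close>, completed by the derivative there.
\<close>

definition sinc_pi :: "complex \<Rightarrow> complex" where
  "sinc_pi z = (if z = 0 then of_real pi else sin (of_real pi * z) / z)"

lemma sinc_pi_holomorphic: "sinc_pi holomorphic_on UNIV"
proof -
  have "((\<lambda>z. sin (of_real pi * z)) has_field_derivative of_real pi) (at (0::complex))"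
    by (auto intro!: derivative_eq_intros)
  then have "deriv (\<lambda>z. sin (of_real pi * z)) (0::complex) = of_real pi"
    by (rule DERIV_imp_deriv)
  then have "sinc_pi = (\<lambda>z. if z = 0 then deriv (\<lambda>z. sin (of_real pi * z)) 0
      else (sin (of_real pi * z) - sin (of_real pi * 0)) / (z - 0))"
    by (auto simp: sinc_pi_def fun_eq_iff)
  moreover have "\<dots> holomorphic_on UNIV"
    by (rule pole_lemma) (auto intro!: holomorphic_intros)
  ultimately show ?thesis by simp
qed

lemma sinc_pi_exp_type: "exp_type_at_most pi sinc_pi"
  unfolding exp_type_at_most_def
proof (intro allI impI)
  fix \<epsilon> :: real assume "\<epsilon> > 0"
  obtain B where B: "B \<ge> 1" "\<And>z. norm z \<le> 1 \<Longrightarrow> norm (sinc_pi z) \<le> B"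
    using continuous_bounded_on_disc[OF holomorphic_on_imp_continuous_on[OF sinc_pi_holomorphic]]
    by blast
  have "norm (sinc_pi z) \<le> B * exp ((pi + \<epsilon>) * norm z)" for z
  proof (cases "norm z \<le> 1")
    case True
    have "B * 1 \<le> B * exp ((pi + \<epsilon>) * norm z)"
      using B(1) \<open>\<epsilon> > 0\<close> by (intro mult_left_mono) auto
    then show ?thesis using B(2)[OF True] by simp
  next
    case False
    have "norm (sinc_pi z) = norm (sin (of_real pi * z)) / norm z"
      using False by (auto simp: sinc_pi_def norm_divide)
    also have "\<dots> \<le> norm (sin (of_real pi * z)) / 1"
      using False by (intro divide_left_mono) auto
    also have "\<dots> \<le> exp \<bar>Im (of_real pi * z)\<bar>"
      using cmod_sin_le_exp[of 1 "of_real pi * z"] by simp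
    also have "\<dots> \<le> exp ((pi + \<epsilon>) * norm z)"
    proof -
      have "\<bar>Im (of_real pi * z)\<bar> = pi * \<bar>Im z\<bar>" by (simp add: abs_mult)
      also have "\<dots> \<le> (pi + \<epsilon>) * norm z"
        using \<open>\<epsilon> > 0\<close> by (intro mult_mono abs_Im_le_cmod) auto
      finally show ?thesis by simp
    qed
    also have "\<dots> \<le> B * exp ((pi + \<epsilon>) * norm z)"
      using B(1) by simp
    finally show ?thesis .
  qed
  then show "\<exists>C. \<forall>z. norm (sinc_pi z) \<le> C * exp ((pi + \<epsilon>) * norm z)" by blast
qed

lemma sinc_pi_square_integrable:
  "integrable lborel (\<lambda>x::real. (norm (sinc_pi (of_real x)))\<^sup>2)"
proof -
  obtain B where B: "B \<ge> 1" "\<And>z. norm z \<le> 1 \<Longrightarrow> norm (sinc_pi z) \<le> B"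
    using continuous_bounded_on_disc[OF holomorphic_on_imp_continuous_on[OF sinc_pi_holomorphic]]
    by blast
  have [measurable]: "sinc_pi \<in> borel_measurable borel"
    using sinc_pi_holomorphic
    by (intro borel_measurable_continuous_onI holomorphic_on_imp_continuous_on)
  have "(norm (sinc_pi (of_real x)))\<^sup>2 \<le> 2 * B\<^sup>2 * inverse (1 + x\<^sup>2)" for x :: real
  proof (cases "\<bar>x\<bar> \<le> 1")
    case True
    then have "(norm (sinc_pi (of_real x)))\<^sup>2 \<le> B\<^sup>2 * 1"
      using B(2)[of "of_real x"] by (simp add: power_mono)
    also have "\<dots> \<le> B\<^sup>2 * (2 * inverse (1 + x\<^sup>2))"
      using True abs_square_le_1[of x]
      by (intro mult_left_mono) (auto simp: field_simps add_pos_nonneg)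
    finally show ?thesis by simp
  next
    case False
    then have "1 < x\<^sup>2" using abs_square_le_1[of x] by linarith
    have "norm (sinc_pi (of_real x)) = \<bar>sin (pi * x)\<bar> / \<bar>x\<bar>"
    proof -
      have "sin (of_real pi * of_real x) = complex_of_real (sin (pi * x))"
        by (metis of_real_mult sin_of_real)
      then show ?thesis using False by (auto simp: sinc_pi_def norm_divide)
    qed
    also have "\<dots> \<le> 1 / \<bar>x\<bar>"
      by (intro divide_right_mono) auto
    finally have "(norm (sinc_pi (of_real x)))\<^sup>2 \<le> (1 / \<bar>x\<bar>)\<^sup>2"
      by (intro power_mono) auto
    also have "\<dots> \<le> 1 * (2 * inverse (1 + x\<^sup>2))"
    proof -
      have "1 / y \<le> 2 / (1 + y)" if "1 < y" for y :: real
        using that by (simp add: field_simps)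
      from this[OF \<open>1 < x\<^sup>2\<close>] have "(1 / \<bar>x\<bar>)\<^sup>2 \<le> 2 / (1 + x\<^sup>2)"
        by (simp add: power_divide)
      then show ?thesis by (simp only: mult_1 divide_inverse)
    qed
    also have "\<dots> \<le> B\<^sup>2 * (2 * inverse (1 + x\<^sup>2))"
      using B(1) by (intro mult_right_mono) (auto simp: one_le_power)
    finally show ?thesis by simp
  qed
  then have "norm ((norm (sinc_pi (of_real x)))\<^sup>2) \<le> norm (2 * B\<^sup>2 * inverse (1 + x\<^sup>2))" for x :: real
    unfolding real_norm_def by (simp only: abs_power2 abs_norm_cancel) (rule order_trans[OF _ abs_ge_self])
  moreover have "integrable lborel (\<lambda>x::real. 2 * B\<^sup>2 * inverse (1 + x\<^sup>2))"
    using integrable_inverse_1_plus_square by (simp add: set_integrable_def)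
  ultimately show ?thesis
    by (rule Bochner_Integration.integrable_bound[rotated 2, OF AE_I2]) measurable
qed

lemma sinc_pi_in_PW: "sinc_pi \<in> PW pi"
  by (simp add: PW_def sinc_pi_holomorphic sinc_pi_exp_type sinc_pi_square_integrable)

section \<open>The Hausdorff operator on the Paley-Wiener space\<close>

theorem proposition9:
  fixes \<mu> :: "real measure" and \<Phi> :: "real \<Rightarrow> complex" and \<delta> :: real
  assumes "regular_borel_measure \<mu>"
    and "\<Phi> \<in> borel_measurable (completion \<mu>)"
    and "\<delta> > 0"
    and "AE u in \<mu>. u \<in> {0<..<\<delta>} \<longrightarrow> \<Phi> u = 0"
  shows "(set_integrable (completion \<mu>) {\<delta>..} (\<lambda>u. \<Phi> u * of_real (sqrt u)) \<longrightarrow>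
            hausdorff_defined_on \<Phi> \<mu> (PW pi) \<and>
            bounded_operator (PW pi) (PW (max pi (pi / \<delta>))) (hausdorff_op \<Phi> \<mu>) \<and>
            operator_norm (PW pi) (hausdorff_op \<Phi> \<mu>)
              \<le> (LINT u:{\<delta>..}|completion \<mu>. norm (\<Phi> u) * sqrt u)) \<and>
         (hausdorff_defined_on \<Phi> \<mu> (PW pi) \<longrightarrow> set_integrable (completion \<mu>) {\<delta>..} \<Phi>)"
proof -
  let ?M = "completion \<mu>"
  define \<Psi> where "\<Psi> u = indicator {\<delta>..} u *\<^sub>R \<Phi> u" for u
  have sets_\<mu>: "sets \<mu> = sets (restrict_space borel {0<..})"
    using assms(1) by (simp add: regular_borel_measure_def)
  then have space_\<mu>: "space \<mu> = {0<..}"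
    using sets_eq_imp_space_eq[OF sets_\<mu>] by (simp add: space_restrict_space)
  have "(\<lambda>u. u) \<in> borel_measurable \<mu>"
    by (subst measurable_cong_sets[OF sets_\<mu> refl]) (simp add: measurable_restrict_space1)
  then have id_meas [measurable]: "(\<lambda>u. u) \<in> borel_measurable ?M"
    by (rule measurable_completion)
  note assms(2) [measurable]
  \<comment> \<open>Almost everywhere the cut-off changes nothing, so the operator is an average of dilations.\<close>
  have AE_eq: "AE u in ?M. \<Phi> u = \<Psi> u"
    using AE_completion[OF assms(4)] AE_space
    by eventually_elim (auto simp: \<Psi>_def space_\<mu> split: split_indicator)
  have [measurable]: "\<Psi> \<in> borel_measurable ?M"
    unfolding \<Psi>_def by measurable
  have op_eq: "hausdorff_op \<Phi> \<mu> F z = (LINT u|?M. \<Psi> u * F (z / of_real u))"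
    if "continuous_on UNIV F" for F z
  proof -
    have [measurable]: "F \<in> borel_measurable borel"
      using that by (rule borel_measurable_continuous_onI)
    show ?thesis
      unfolding hausdorff_op_def
      by (rule integral_cong_AE) (measurable, use AE_eq in eventually_elim, simp)
  qed
  have part1: "hausdorff_defined_on \<Phi> \<mu> (PW pi) \<and>
      bounded_operator (PW pi) (PW (max pi (pi / \<delta>))) (hausdorff_op \<Phi> \<mu>) \<and>
      operator_norm (PW pi) (hausdorff_op \<Phi> \<mu>)
        \<le> (LINT u:{\<delta>..}|?M. norm (\<Phi> u) * sqrt u)"
    if weighted: "set_integrable ?M {\<delta>..} (\<lambda>u. \<Phi> u * of_real (sqrt u))"
  proof -
    define W where "W = (LINT u|?M. norm (\<Psi> u) * sqrt u)"
    have weighted': "integrable ?M (\<lambda>u. \<Psi> u * of_real (sqrt u))"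
      using weighted by (simp add: set_integrable_def \<Psi>_def)
    have norm_weighted: "norm (\<Psi> u * of_real (sqrt u)) = norm (\<Psi> u) * sqrt u" for u
      using assms(3) by (auto simp: \<Psi>_def norm_mult split: split_indicator)
    have W_int: "integrable ?M (\<lambda>u. norm (\<Psi> u) * sqrt u)"
      using integrable_norm[OF weighted'] by (simp only: norm_weighted)
    have W_eq: "W = (LINT u:{\<delta>..}|?M. norm (\<Phi> u) * sqrt u)"
      unfolding W_def set_lebesgue_integral_def \<Psi>_def
      by (intro Bochner_Integration.integral_cong) (auto split: split_indicator)
    have W_nonneg: "W \<ge> 0"
      unfolding W_def norm_weighted[symmetric] by simp
    have \<Psi>_int: "integrable ?M \<Psi>"
    proof (rule Bochner_Integration.integrable_bound)
      show "integrable ?M (\<lambda>u. (norm (\<Psi> u) * sqrt u) / sqrt \<delta>)"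
        using W_int by simp
      have "norm (\<Psi> u) \<le> norm (\<Psi> u) * sqrt u / sqrt \<delta>" for u
      proof (cases "u < \<delta>")
        case False
        then have "norm (\<Psi> u) * 1 \<le> norm (\<Psi> u) * (sqrt u / sqrt \<delta>)"
          using assms(3) by (intro mult_left_mono) auto
        then show ?thesis by simp
      qed (simp add: \<Psi>_def)
      then have "norm (\<Psi> u) \<le> norm (norm (\<Psi> u) * sqrt u / sqrt \<delta>)" for u
        unfolding real_norm_def by (rule order_trans[OF _ abs_ge_self])
      then show "AE u in ?M. norm (\<Psi> u) \<le> norm (norm (\<Psi> u) * sqrt u / sqrt \<delta>)"
        by simp
    qed measurable
    interpret dilation_average ?M \<Psi> \<delta>
      using assms(3) id_meas \<Psi>_int by unfold_locales (auto simp: \<Psi>_def)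
    have cont: "continuous_on UNIV F" if "F \<in> PW pi" for F
      using that by (auto simp: PW_def intro: holomorphic_on_imp_continuous_on)
    have op_average: "hausdorff_op \<Phi> \<mu> F = average F" if "continuous_on UNIV F" for F
      using op_eq[OF that] by (auto simp: average_def)
    have defined: "hausdorff_defined_on \<Phi> \<mu> (PW pi)"
      unfolding hausdorff_defined_on_def
    proof (intro ballI allI)
      fix F z assume "F \<in> PW pi"
      then have F: "continuous_on UNIV F" by (rule cont)
      then have [measurable]: "F \<in> borel_measurable borel"
        by (rule borel_measurable_continuous_onI)
      show "integrable ?M (\<lambda>u. \<Phi> u * F (z / of_real u))"
        by (rule integrable_cong_AE_imp[OF integrand_integrable[OF F, of z]])
           (measurable, use AE_eq in eventually_elim, simp)
    qed
    have norm_le: "PW_norm (hausdorff_op \<Phi> \<mu> F) \<le> W * PW_norm F" if "F \<in> PW pi" for F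
      using dilation_average_PW(2)[OF that _ W_int] op_average[OF cont[OF that]]
      by (simp add: W_def)
    have "hausdorff_op \<Phi> \<mu> F \<in> PW (max pi (pi / \<delta>))" if "F \<in> PW pi" for F
      using dilation_average_PW(1)[OF that _ W_int] op_average[OF cont[OF that]]
        PW_mono[of "pi / \<delta>" "max pi (pi / \<delta>)"] by auto
    moreover have "hausdorff_op \<Phi> \<mu> (\<lambda>z. a * F z + b * G z)
        = (\<lambda>z. a * hausdorff_op \<Phi> \<mu> F z + b * hausdorff_op \<Phi> \<mu> G z)"
      if "F \<in> PW pi" "G \<in> PW pi" for F G a b
    proof
      fix z
      have "integrable ?M (\<lambda>u. \<Phi> u * F (z / of_real u))" "integrable ?M (\<lambda>u. \<Phi> u * G (z / of_real u))"
        using defined that by (auto simp: hausdorff_defined_on_def)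
      then have "(LINT u|?M. a * (\<Phi> u * F (z / of_real u)) + b * (\<Phi> u * G (z / of_real u)))
          = a * hausdorff_op \<Phi> \<mu> F z + b * hausdorff_op \<Phi> \<mu> G z"
        by (simp add: hausdorff_op_def)
      then show "hausdorff_op \<Phi> \<mu> (\<lambda>z. a * F z + b * G z) z
          = a * hausdorff_op \<Phi> \<mu> F z + b * hausdorff_op \<Phi> \<mu> G z"
        by (simp add: hausdorff_op_def algebra_simps)
    qed
    ultimately have "bounded_operator (PW pi) (PW (max pi (pi / \<delta>))) (hausdorff_op \<Phi> \<mu>)"
      unfolding bounded_operator_def using norm_le by blast
    moreover have "operator_norm (PW pi) (hausdorff_op \<Phi> \<mu>) \<le> W"
      unfolding operator_norm_def
    proof (rule cSUP_least)
      have "(\<lambda>z. 0) \<in> PW pi"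
        by (auto simp: PW_def exp_type_at_most_def intro!: exI[of _ 0])
      moreover have "PW_norm (\<lambda>z. 0) \<le> 1" by (simp add: PW_norm_def)
      ultimately show "{F \<in> PW pi. PW_norm F \<le> 1} \<noteq> {}" by blast
      fix F assume "F \<in> {F \<in> PW pi. PW_norm F \<le> 1}"
      then show "PW_norm (hausdorff_op \<Phi> \<mu> F) \<le> W"
        using norm_le[of F] mult_left_mono[OF _ W_nonneg, of "PW_norm F" 1] by simp
    qed
    ultimately show ?thesis
      using defined W_eq by simp
  qed
  have part2: "set_integrable ?M {\<delta>..} \<Phi>" if "hausdorff_defined_on \<Phi> \<mu> (PW pi)"
  proof -
    \<comment> \<open>Evaluating the image at \<open>0\<close> turns the integrand into \<open>\<Phi>(u) \<pi>\<close>.\<close>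
    have "integrable ?M (\<lambda>u. \<Phi> u * sinc_pi (0 / of_real u))"
      using that sinc_pi_in_PW unfolding hausdorff_defined_on_def by blast
    then have "integrable ?M (\<lambda>u. \<Phi> u * of_real pi)" by (simp add: sinc_pi_def)
    then have "integrable ?M (\<lambda>u. \<Phi> u * of_real pi * (1 / of_real pi))"
      by (rule integrable_mult_left)
    then have "integrable ?M \<Phi>" by simp
    then have "integrable ?M \<Psi>"
      by (rule integrable_cong_AE_imp) (measurable, use AE_eq in eventually_elim, simp)
    then show ?thesis unfolding set_integrable_def \<Psi>_def .
  qed
  show ?thesis using part1 part2 by blast
qed

end
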